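(* Let $R\ge 2r>0$, $d=\sqrt{R(R-2r)}$, and consider the Poristic family with circumradius $R$ and inradius $r$. For a Poristic triangle $T$ let $E_1$ be the circumconic of $T$ centered on its incenter $X_1$, with major and minor semiaxes $\eta_1\ge\zeta_1$. Then $\eta_1=R+d$ and $\zeta_1=R-d$ for every $T$ in the family; i.e. over the family $E_1$ rigidly rotates about the fixed point $X_1$.
   Context: Poristic family: fix in the plane a circle (the circumcircle) with center $X_3$ and radius $R$ and a circle (the incircle) with center $X_1$ and radius $r$, where $|X_1X_3|=d=\sqrt{R(R-2r)}$. The Poristic family is the one-parameter family of all triangles having these two circles as circumcircle and incircle. A circumconic of a triangle centered on a given point is the conic with that center passing through the three vertices of the triangle. *)

theory Defs
  imports "HOL-Analysis.Analysis"
begin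

definition tangent_to_circle :: "(real^2) set \<Rightarrow> real^2 \<Rightarrow> real \<Rightarrow> bool" where
  "tangent_to_circle L X r \<longleftrightarrow> (\<exists>T. L \<inter> sphere X r = {T})"

definition is_triangle :: "real^2 \<Rightarrow> real^2 \<Rightarrow> real^2 \<Rightarrow> bool" where
  "is_triangle A B C \<longleftrightarrow> \<not> collinear {A, B, C}"

definition is_circumcircle :: "real^2 \<Rightarrow> real \<Rightarrow> real^2 \<Rightarrow> real^2 \<Rightarrow> real^2 \<Rightarrow> bool" where
  "is_circumcircle X R A B C \<longleftrightarrow> {A, B, C} \<subseteq> sphere X R"

text \<open>The interior condition separates the incircle from the three excircles.\<close>

definition is_incircle :: "real^2 \<Rightarrow> real \<Rightarrow> real^2 \<Rightarrow> real^2 \<Rightarrow> real^2 \<Rightarrow> bool" where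
  "is_incircle X r A B C \<longleftrightarrow>
     X \<in> interior (convex hull {A, B, C}) \<and>
     tangent_to_circle (affine hull {A, B}) X r \<and>
     tangent_to_circle (affine hull {B, C}) X r \<and>
     tangent_to_circle (affine hull {C, A}) X r"

definition poristic ::
  "real^2 \<Rightarrow> real \<Rightarrow> real^2 \<Rightarrow> real \<Rightarrow> real^2 \<Rightarrow> real^2 \<Rightarrow> real^2 \<Rightarrow> bool" where
  "poristic X3 R X1 r A B C \<longleftrightarrow>
     is_triangle A B C \<and> is_circumcircle X3 R A B C \<and> is_incircle X1 r A B C"

text \<open>Zero sets of real polynomials of degree exactly two; ellipses, parabolas, hyperbolas and
  degenerate conics are all included.\<close>

definition is_conic :: "(real^2) set \<Rightarrow> bool" where
  "is_conic E \<longleftrightarrow>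
     (\<exists>a b c k l m. (a \<noteq> 0 \<or> b \<noteq> 0 \<or> c \<noteq> 0) \<and>
        E = {p. a * (p$1)\<^sup>2 + b * p$1 * p$2 + c * (p$2)\<^sup>2 + k * p$1 + l * p$2 + m = 0})"

text \<open>\<open>P\<close> is a centre of \<open>E\<close> if the half-turn about \<open>P\<close> maps \<open>E\<close> onto itself.\<close>

definition is_center :: "real^2 \<Rightarrow> (real^2) set \<Rightarrow> bool" where
  "is_center P E \<longleftrightarrow> (\<lambda>p. 2 *\<^sub>R P - p) ` E = E"

definition is_circumconic ::
  "(real^2) set \<Rightarrow> real^2 \<Rightarrow> real^2 \<Rightarrow> real^2 \<Rightarrow> real^2 \<Rightarrow> bool" where
  "is_circumconic E P A B C \<longleftrightarrow> is_conic E \<and> is_center P E \<and> {A, B, C} \<subseteq> E"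

definition ellipse_with_semiaxes :: "(real^2) set \<Rightarrow> real^2 \<Rightarrow> real \<Rightarrow> real \<Rightarrow> bool" where
  "ellipse_with_semiaxes E P \<eta> \<zeta> \<longleftrightarrow>
     \<eta> \<ge> \<zeta> \<and> \<zeta> > 0 \<and>
     (\<exists>u v. norm u = 1 \<and> norm v = 1 \<and> u \<bullet> v = 0 \<and>
        E = {P + x *\<^sub>R u + y *\<^sub>R v | x y. (x / \<eta>)\<^sup>2 + (y / \<zeta>)\<^sup>2 = 1})"

end

theory Submission imports Defs
begin

text \<open>Put the incentre at the origin of the complex plane and let \<open>u, v, w\<close> be the unit normals
  pointing to the contact points of the incircle, so that the vertices are \<open>2 r v w / (v + w)\<close> and
  its cyclic variants. Writing the circumcircle condition at each vertex turns it into one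
  quadratic equation, the same for \<open>u\<close>, \<open>v\<close> and \<open>w\<close>; its leading coefficient must vanish, which
  says that the circumcentre is \<open>- R (u + v + w)\<close>. Hence \<open>\<bar>u + v + w\<bar> = d / R\<close>. On the other hand
  the vertices satisfy
  \<open>(1 + \<bar>e\<bar>\<^sup>2) \<bar>z\<bar>\<^sup>2 - 2 Re (g z\<^sup>2) = 4 r\<^sup>2\<close> with \<open>e = u + v + w\<close> and \<open>g = e / (u v w)\<close>, a conic centred
  at the origin whose semiaxes \<open>2 r / (1 \<mp> \<bar>e\<bar>)\<close> are \<open>R \<plusminus> d\<close>, because \<open>2 R r = R\<^sup>2 - d\<^sup>2\<close>.
  It is the only conic through the vertices with this centre, because a binary quadratic form with
  three zeros in pairwise different directions vanishes.\<close>

section \<open>Ellipses in a rotated frame\<close>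

definition rot90 :: "real^2 \<Rightarrow> real^2" where
  "rot90 u = vector [- u$2, u$1]"

lemma rot90_nth [simp]: "rot90 u $ 1 = - u$2" "rot90 u $ 2 = u$1"
  by (simp_all add: rot90_def)

lemma inner_vec2: "x \<bullet> y = x$1 * y$1 + x$2 * y$2" for x y :: "real^2"
  by (simp add: inner_vec_def sum_2)

lemma norm_eq_1_vec2: "norm u = 1 \<longleftrightarrow> (u$1)\<^sup>2 + (u$2)\<^sup>2 = 1" for u :: "real^2"
  by (simp add: norm_eq_1 inner_vec2 power2_eq_square)

lemma vec2_eq_iff: "x = y \<longleftrightarrow> x$1 = y$1 \<and> x$2 = y$2" for x y :: "real^2"
  by (simp add: vec_eq_iff forall_2)

text \<open>In the plane the vectors orthogonal to \<open>u\<close> form the line spanned by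
  \<open>rot90 u\<close>, so the second axis of an ellipse is determined by the first up to
  sign.\<close>

lemma orthogonal_unit_vec2:
  fixes u v :: "real^2"
  assumes u: "norm u = 1" and v: "norm v = 1" and uv: "u \<bullet> v = 0"
  shows "v = rot90 u \<or> v = - rot90 u"
proof -
  define t where "t = v \<bullet> rot90 u"
  have uu: "(u$1)\<^sup>2 + (u$2)\<^sup>2 = 1" and vv: "(v$1)\<^sup>2 + (v$2)\<^sup>2 = 1"
    and "u$1 * v$1 + u$2 * v$2 = 0"
    using assms by (simp_all add: norm_eq_1_vec2 inner_vec2)
  moreover have t: "t = - v$1 * u$2 + v$2 * u$1"
    by (simp add: t_def inner_vec2)
  ultimately have "v$1 = - t * u$2" "v$2 = t * u$1" "t\<^sup>2 = 1"
    by algebra+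
  then have "v = t *\<^sub>R rot90 u"
    by (simp add: vec2_eq_iff)
  with \<open>t\<^sup>2 = 1\<close> show ?thesis
    by (auto simp: power2_eq_1_iff)
qed

lemma frame_expansion:
  fixes u z :: "real^2"
  assumes "norm u = 1"
  shows "z = (z \<bullet> u) *\<^sub>R u + (z \<bullet> rot90 u) *\<^sub>R rot90 u"
proof -
  have "(u$1)\<^sup>2 + (u$2)\<^sup>2 = 1"
    using assms by (simp add: norm_eq_1_vec2)
  then show ?thesis
    unfolding vec2_eq_iff by (simp add: inner_vec2) algebra
qed

text \<open>Implicit form of the parametrised set in \<open>ellipse_with_semiaxes\<close>. A single
  direction \<open>u\<close> fixes the frame, so all later work has one unknown direction instead of
  two.\<close>

definition frame_ellipse :: "real^2 \<Rightarrow> real^2 \<Rightarrow> real \<Rightarrow> real \<Rightarrow> (real^2) set" where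
  "frame_ellipse P u \<eta> \<zeta> =
     {p. (((p - P) \<bullet> u) / \<eta>)\<^sup>2 + (((p - P) \<bullet> rot90 u) / \<zeta>)\<^sup>2 = 1}"

lemma frame_ellipse_parametric:
  assumes u: "norm u = 1"
  shows "{P + x *\<^sub>R u + y *\<^sub>R rot90 u | x y. (x / \<eta>)\<^sup>2 + (y / \<zeta>)\<^sup>2 = 1} = frame_ellipse P u \<eta> \<zeta>"
proof (intro equalityI subsetI)
  fix p assume "p \<in> {P + x *\<^sub>R u + y *\<^sub>R rot90 u | x y. (x / \<eta>)\<^sup>2 + (y / \<zeta>)\<^sup>2 = 1}"
  then obtain x y where p: "p = P + x *\<^sub>R u + y *\<^sub>R rot90 u"
    and xy: "(x / \<eta>)\<^sup>2 + (y / \<zeta>)\<^sup>2 = 1" by blast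
  have "(u$1)\<^sup>2 + (u$2)\<^sup>2 = 1"
    using u by (simp add: norm_eq_1_vec2)
  then have "(p - P) \<bullet> u = x" "(p - P) \<bullet> rot90 u = y"
    unfolding p inner_vec2 by (simp_all) algebra+
  then show "p \<in> frame_ellipse P u \<eta> \<zeta>"
    using xy by (simp add: frame_ellipse_def)
next
  fix p assume p: "p \<in> frame_ellipse P u \<eta> \<zeta>"
  have "p = P + ((p - P) \<bullet> u) *\<^sub>R u + ((p - P) \<bullet> rot90 u) *\<^sub>R rot90 u"
    using frame_expansion[OF u, of "p - P"] by (simp add: algebra_simps)
  then show "p \<in> {P + x *\<^sub>R u + y *\<^sub>R rot90 u | x y. (x / \<eta>)\<^sup>2 + (y / \<zeta>)\<^sup>2 = 1}"
    using p unfolding frame_ellipse_def by blast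
qed

text \<open>The sign left open by \<open>orthogonal_unit_vec2\<close> is absorbed by replacing
  \<open>y\<close> with \<open>- y\<close> in the parametrisation.\<close>

lemma ellipse_with_semiaxes_iff:
  "ellipse_with_semiaxes E P \<eta> \<zeta> \<longleftrightarrow>
     \<eta> \<ge> \<zeta> \<and> \<zeta> > 0 \<and> (\<exists>u. norm u = 1 \<and> E = frame_ellipse P u \<eta> \<zeta>)"
proof -
  have *: "{P + x *\<^sub>R u + y *\<^sub>R (- v) | x y. (x / \<eta>)\<^sup>2 + (y / \<zeta>)\<^sup>2 = 1} =
      {P + x *\<^sub>R u + y *\<^sub>R v | x y. (x / \<eta>)\<^sup>2 + (y / \<zeta>)\<^sup>2 = 1}" (is "?S (- v) = ?S v") for u v
  proof -
    have "?S (- w) \<subseteq> ?S w" for w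
    proof
      fix p assume "p \<in> ?S (- w)"
      then obtain x y where "p = P + x *\<^sub>R u + y *\<^sub>R (- w)" "(x / \<eta>)\<^sup>2 + (y / \<zeta>)\<^sup>2 = 1" by blast
      then have "p = P + x *\<^sub>R u + (- y) *\<^sub>R w \<and> (x / \<eta>)\<^sup>2 + ((- y) / \<zeta>)\<^sup>2 = 1" by simp
      then show "p \<in> ?S w" by blast
    qed
    from this[of v] this[of "- v"] show ?thesis by auto
  qed
  have "(\<exists>u v. norm u = 1 \<and> norm v = 1 \<and> u \<bullet> v = 0 \<and>
        E = {P + x *\<^sub>R u + y *\<^sub>R v | x y. (x / \<eta>)\<^sup>2 + (y / \<zeta>)\<^sup>2 = 1}) \<longleftrightarrow>
      (\<exists>u. norm u = 1 \<and> E = frame_ellipse P u \<eta> \<zeta>)" (is "?L \<longleftrightarrow> ?R")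
  proof
    assume ?L
    then obtain u v where uv: "norm u = 1" "norm v = 1" "u \<bullet> v = 0"
      and E: "E = {P + x *\<^sub>R u + y *\<^sub>R v | x y. (x / \<eta>)\<^sup>2 + (y / \<zeta>)\<^sup>2 = 1}" by blast
    have "E = frame_ellipse P u \<eta> \<zeta>"
      unfolding frame_ellipse_parametric[OF uv(1), symmetric]
      using orthogonal_unit_vec2[OF uv]
    proof
      assume v: "v = rot90 u"
      show "E = {P + x *\<^sub>R u + y *\<^sub>R rot90 u | x y. (x / \<eta>)\<^sup>2 + (y / \<zeta>)\<^sup>2 = 1}"
        unfolding E v by (rule refl)
    next
      assume v: "v = - rot90 u"
      show "E = {P + x *\<^sub>R u + y *\<^sub>R rot90 u | x y. (x / \<eta>)\<^sup>2 + (y / \<zeta>)\<^sup>2 = 1}"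
        unfolding E v by (rule *)
    qed
    with uv show ?R by blast
  next
    assume ?R
    then obtain u where u: "norm u = 1" "E = frame_ellipse P u \<eta> \<zeta>" by blast
    moreover have "norm (rot90 u) = 1" "u \<bullet> rot90 u = 0"
      using u(1) by (simp_all add: norm_eq_1_vec2 inner_vec2 add.commute)
    ultimately show ?L
      unfolding frame_ellipse_parametric[OF u(1), symmetric] by blast
  qed
  then show ?thesis
    unfolding ellipse_with_semiaxes_def by simp
qed

section \<open>Semiaxes as extreme distances from the centre\<close>

lemma frame_pythagoras:
  assumes "norm u = 1"
  shows "(z \<bullet> u)\<^sup>2 + (z \<bullet> rot90 u)\<^sup>2 = (norm z)\<^sup>2"
proof -
  have "(u$1)\<^sup>2 + (u$2)\<^sup>2 = 1"
    using assms by (simp add: norm_eq_1_vec2)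
  then show ?thesis
    unfolding power2_norm_eq_inner inner_vec2 by simp algebra
qed

text \<open>Replacing both denominators by the smaller one, or both by the larger one, turns the
  equation of the ellipse into a bound on the squared distance from \<open>P\<close>.\<close>

lemma frame_ellipse_norm_bounds:
  assumes "norm u = 1" "\<zeta> \<le> \<eta>" "0 < \<zeta>" "p \<in> frame_ellipse P u \<eta> \<zeta>"
  shows "\<zeta> \<le> norm (p - P)" "norm (p - P) \<le> \<eta>"
proof -
  let ?x = "(p - P) \<bullet> u" and ?y = "(p - P) \<bullet> rot90 u"
  have e: "?x\<^sup>2 / \<eta>\<^sup>2 + ?y\<^sup>2 / \<zeta>\<^sup>2 = 1"
    using assms(4) by (simp add: frame_ellipse_def power_divide)
  have n: "(norm (p - P))\<^sup>2 = ?x\<^sup>2 + ?y\<^sup>2"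
    using frame_pythagoras[OF assms(1)] by metis
  have le: "\<zeta>\<^sup>2 \<le> \<eta>\<^sup>2"
    using assms by (intro power_mono) auto
  have "?x\<^sup>2 / \<eta>\<^sup>2 \<le> ?x\<^sup>2 / \<zeta>\<^sup>2" "?y\<^sup>2 / \<eta>\<^sup>2 \<le> ?y\<^sup>2 / \<zeta>\<^sup>2"
    using assms le by (auto intro!: divide_left_mono)
  with e have "1 \<le> (?x\<^sup>2 + ?y\<^sup>2) / \<zeta>\<^sup>2" "(?x\<^sup>2 + ?y\<^sup>2) / \<eta>\<^sup>2 \<le> 1"
    by (simp_all add: add_divide_distrib)
  then have "\<zeta>\<^sup>2 \<le> (norm (p - P))\<^sup>2" "(norm (p - P))\<^sup>2 \<le> \<eta>\<^sup>2"
    using assms by (simp_all add: n field_simps)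
  then show "\<zeta> \<le> norm (p - P)" "norm (p - P) \<le> \<eta>"
    using assms by (auto intro: power2_le_imp_le)
qed

lemma frame_ellipse_vertices:
  assumes "norm u = 1" "\<eta> \<noteq> 0" "\<zeta> \<noteq> 0"
  shows "P + \<eta> *\<^sub>R u \<in> frame_ellipse P u \<eta> \<zeta>" "P + \<zeta> *\<^sub>R rot90 u \<in> frame_ellipse P u \<eta> \<zeta>"
    "norm (rot90 u) = 1"
proof -
  have "u \<bullet> u = 1" "rot90 u \<bullet> rot90 u = 1" "u \<bullet> rot90 u = 0" "rot90 u \<bullet> u = 0"
    using assms(1) by (simp_all add: norm_eq_1 inner_vec2)
  then show "P + \<eta> *\<^sub>R u \<in> frame_ellipse P u \<eta> \<zeta>" "P + \<zeta> *\<^sub>R rot90 u \<in> frame_ellipse P u \<eta> \<zeta>"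
    "norm (rot90 u) = 1"
    using assms by (simp_all add: frame_ellipse_def norm_eq_1)
qed

text \<open>The axis endpoints of the first ellipse lie on the second and obey its distance bounds.
  The reverse inequalities follow by exchanging the two ellipses.\<close>

lemma frame_ellipse_semiaxes_unique:
  assumes u: "norm u = 1" "\<zeta> \<le> \<eta>" "0 < \<zeta>" and u': "norm u' = 1" "\<zeta>' \<le> \<eta>'" "0 < \<zeta>'"
    and eq: "frame_ellipse P u \<eta> \<zeta> = frame_ellipse P u' \<eta>' \<zeta>'"
  shows "\<eta> \<le> \<eta>'" "\<zeta>' \<le> \<zeta>"
proof -
  have "P + \<eta> *\<^sub>R u \<in> frame_ellipse P u' \<eta>' \<zeta>'" "P + \<zeta> *\<^sub>R rot90 u \<in> frame_ellipse P u' \<eta>' \<zeta>'"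
    using frame_ellipse_vertices(1,2)[OF u(1), of \<eta> \<zeta> P] assms by auto
  from frame_ellipse_norm_bounds(2)[OF u' this(1)] frame_ellipse_norm_bounds(1)[OF u' this(2)]
  show "\<eta> \<le> \<eta>'" "\<zeta>' \<le> \<zeta>"
    using u frame_ellipse_vertices(3)[OF u(1), of \<eta> \<zeta>] by auto
qed

lemma ellipse_with_semiaxes_unique:
  assumes "ellipse_with_semiaxes E P \<eta> \<zeta>" "ellipse_with_semiaxes E P \<eta>' \<zeta>'"
  shows "\<eta> = \<eta>' \<and> \<zeta> = \<zeta>'"
proof -
  obtain u where u: "norm u = 1" "\<zeta> \<le> \<eta>" "0 < \<zeta>" "E = frame_ellipse P u \<eta> \<zeta>"
    using assms(1) by (auto simp: ellipse_with_semiaxes_iff)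
  obtain u' where u': "norm u' = 1" "\<zeta>' \<le> \<eta>'" "0 < \<zeta>'" "E = frame_ellipse P u' \<eta>' \<zeta>'"
    using assms(2) by (auto simp: ellipse_with_semiaxes_iff)
  have eq: "frame_ellipse P u \<eta> \<zeta> = frame_ellipse P u' \<eta>' \<zeta>'"
    using u(4) u'(4) by simp
  show ?thesis
    using frame_ellipse_semiaxes_unique[OF u(1-3) u'(1-3) eq]
      frame_ellipse_semiaxes_unique[OF u'(1-3) u(1-3) eq [symmetric]] by simp
qed

text \<open>\<open>Q\<close> is the rotation taking \<open>u\<close> to \<open>u'\<close>;
  \<open>c\<close> and \<open>s\<close> are the cosine and sine of the angle between them.\<close>

lemma frame_ellipse_rotation:
  fixes P u u' :: "real^2"
  assumes u: "norm u = 1" and u': "norm u' = 1"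
  shows "\<exists>Q :: real^2^2. rotation_matrix Q \<and>
    frame_ellipse P u' \<eta> \<zeta> = (\<lambda>p. P + Q *v (p - P)) ` frame_ellipse P u \<eta> \<zeta>"
proof -
  define c where "c = u' \<bullet> u"
  define s where "s = u' \<bullet> rot90 u"
  define Q :: "real^2^2" where "Q = vector [vector [c, - s], vector [s, c]]"
  have uu: "(u$1)\<^sup>2 + (u$2)\<^sup>2 = 1" and uu': "(u'$1)\<^sup>2 + (u'$2)\<^sup>2 = 1"
    using assms by (simp_all add: norm_eq_1_vec2)
  have cs: "c\<^sup>2 + s\<^sup>2 = 1"
    using frame_pythagoras[OF u, of u'] u' by (simp add: c_def s_def)
  have Q_nth: "(Q *v z) $ 1 = c * z$1 - s * z$2" "(Q *v z) $ 2 = s * z$1 + c * z$2" for z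
    by (simp_all add: Q_def matrix_vector_mult_def sum_2)
  have QT_nth: "(transpose Q *v z) $ 1 = c * z$1 + s * z$2"
    "(transpose Q *v z) $ 2 = - s * z$1 + c * z$2" for z
    by (simp_all add: Q_def transpose_def matrix_vector_mult_def sum_2)
  have QQT: "Q *v (transpose Q *v z) = z" for z
    using cs unfolding vec2_eq_iff Q_nth QT_nth by algebra
  have "transpose Q *v (Q *v z) = z" for z
    using cs unfolding vec2_eq_iff Q_nth QT_nth by algebra
  then have "transpose Q ** Q = mat 1"
    by (simp add: matrix_eq matrix_vector_mul_assoc [symmetric])
  then have "rotation_matrix Q"
    using cs by (simp add: rotation_matrix_def orthogonal_matrix det_2 Q_def power2_eq_square)
  have c: "c = u'$1 * u$1 + u'$2 * u$2" and s: "s = u'$2 * u$1 - u'$1 * u$2"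
    by (simp_all add: c_def s_def inner_vec2)
  \<comment> \<open>The coordinates of \<open>Q *v z\<close> in the new frame are those of
    \<open>z\<close> in the old one, so the two implicit equations correspond.\<close>
  have inner_Q: "(Q *v z) \<bullet> u' = z \<bullet> u" "(Q *v z) \<bullet> rot90 u' = z \<bullet> rot90 u" for z
    using uu' unfolding inner_vec2 Q_nth c s by simp_all algebra+
  have mem: "P + Q *v (p - P) \<in> frame_ellipse P u' \<eta> \<zeta> \<longleftrightarrow> p \<in> frame_ellipse P u \<eta> \<zeta>" for p
    by (simp add: frame_ellipse_def inner_Q)
  have "frame_ellipse P u' \<eta> \<zeta> = (\<lambda>p. P + Q *v (p - P)) ` frame_ellipse P u \<eta> \<zeta>"
  proof (intro equalityI subsetI)
    fix p assume p: "p \<in> frame_ellipse P u' \<eta> \<zeta>"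
    define p' where "p' = P + transpose Q *v (p - P)"
    have p': "p = P + Q *v (p' - P)"
      unfolding p'_def add_diff_cancel_left' QQT by simp
    have "p' \<in> frame_ellipse P u \<eta> \<zeta>"
      using p mem[of p'] unfolding p'[symmetric] by (rule iffD1[rotated])
    with p' show "p \<in> (\<lambda>p. P + Q *v (p - P)) ` frame_ellipse P u \<eta> \<zeta>"
      by (rule image_eqI)
  next
    fix p assume "p \<in> (\<lambda>p. P + Q *v (p - P)) ` frame_ellipse P u \<eta> \<zeta>"
    then obtain p' where p': "p = P + Q *v (p' - P)" and "p' \<in> frame_ellipse P u \<eta> \<zeta>"
      by (rule imageE)
    then show "p \<in> frame_ellipse P u' \<eta> \<zeta>"
      unfolding p' by (intro mem [THEN iffD2])
  qed
  with \<open>rotation_matrix Q\<close> show ?thesis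
    by (intro exI[of _ Q] conjI)
qed

section \<open>Conics through three points with a given centre\<close>

lemma frame_ellipse_quadratic:
  obtains a b c where
    "frame_ellipse P u \<eta> \<zeta> =
       {p. a * ((p - P)$1)\<^sup>2 + b * (p - P)$1 * (p - P)$2 + c * ((p - P)$2)\<^sup>2 = 1}"
proof
  let ?a = "(u$1)\<^sup>2 / \<eta>\<^sup>2 + (u$2)\<^sup>2 / \<zeta>\<^sup>2"
    and ?b = "2 * (u$1) * (u$2) / \<eta>\<^sup>2 - 2 * (u$1) * (u$2) / \<zeta>\<^sup>2"
    and ?c = "(u$2)\<^sup>2 / \<eta>\<^sup>2 + (u$1)\<^sup>2 / \<zeta>\<^sup>2"
  have "((z \<bullet> u) / \<eta>)\<^sup>2 + ((z \<bullet> rot90 u) / \<zeta>)\<^sup>2 = ?a * (z$1)\<^sup>2 + ?b * z$1 * z$2 + ?c * (z$2)\<^sup>2"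
    for z :: "real^2"
    by (simp add: inner_vec2 power_divide divide_inverse power2_eq_square algebra_simps)
  then show "frame_ellipse P u \<eta> \<zeta> =
       {p. ?a * ((p - P)$1)\<^sup>2 + ?b * (p - P)$1 * (p - P)$2 + ?c * ((p - P)$2)\<^sup>2 = 1}"
    by (simp only: frame_ellipse_def)
qed

lemma frame_ellipse_is_conic:
  assumes "A \<in> frame_ellipse P u \<eta> \<zeta>"
  shows "is_conic (frame_ellipse P u \<eta> \<zeta>)"
proof -
  obtain a b c where E: "frame_ellipse P u \<eta> \<zeta> =
       {p. a * ((p - P)$1)\<^sup>2 + b * (p - P)$1 * (p - P)$2 + c * ((p - P)$2)\<^sup>2 = 1}"
    using frame_ellipse_quadratic .
  \<comment> \<open>With all three coefficients zero the equation would read \<open>0 = 1\<close>,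
    but \<open>A\<close> satisfies it.\<close>
  have "a \<noteq> 0 \<or> b \<noteq> 0 \<or> c \<noteq> 0"
    using assms unfolding E by auto
  moreover have "frame_ellipse P u \<eta> \<zeta> = {p. a * (p$1)\<^sup>2 + b * p$1 * p$2 + c * (p$2)\<^sup>2
      + (- 2 * a * P$1 - b * P$2) * p$1 + (- 2 * c * P$2 - b * P$1) * p$2
      + (a * (P$1)\<^sup>2 + b * P$1 * P$2 + c * (P$2)\<^sup>2 - 1) = 0}"
    unfolding E by (auto simp: power2_eq_square algebra_simps)
  ultimately show ?thesis
    unfolding is_conic_def by blast
qed

lemma frame_ellipse_is_center: "is_center P (frame_ellipse P u \<eta> \<zeta>)"
proof -
  have *: "2 *\<^sub>R P - p \<in> frame_ellipse P u \<eta> \<zeta>" if "p \<in> frame_ellipse P u \<eta> \<zeta>" for p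
  proof -
    have "2 *\<^sub>R P - p - P = - (p - P)"
      by (simp add: scaleR_2)
    then show ?thesis
      using that unfolding frame_ellipse_def mem_Collect_eq
      by (simp only: inner_minus_left minus_divide_left [symmetric] power2_minus)
  qed
  show ?thesis
    unfolding is_center_def
  proof (intro equalityI subsetI)
    fix p assume "p \<in> frame_ellipse P u \<eta> \<zeta>"
    then show "p \<in> (\<lambda>p. 2 *\<^sub>R P - p) ` frame_ellipse P u \<eta> \<zeta>"
      by (intro image_eqI[of _ _ "2 *\<^sub>R P - p"] *) auto
  qed (use * in auto)
qed

section \<open>Uniqueness of the centred circumconic\<close>

definition cross2 :: "real^2 \<Rightarrow> real^2 \<Rightarrow> real" where
  "cross2 x y = x$1 * y$2 - x$2 * y$1"

text \<open>A homogeneous Vandermonde argument: the linear system for \<open>a\<close>,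
  \<open>b\<close>, \<open>c\<close> has determinant equal, up to sign, to the product of the three
  \<open>cross2\<close> values.\<close>

lemma binary_quadratic_form_eq_0:
  fixes x y z :: "real^2"
  assumes ne: "cross2 x y \<noteq> 0" "cross2 y z \<noteq> 0" "cross2 z x \<noteq> 0"
    and x: "a * (x$1)\<^sup>2 + b * x$1 * x$2 + c * (x$2)\<^sup>2 = 0"
    and y: "a * (y$1)\<^sup>2 + b * y$1 * y$2 + c * (y$2)\<^sup>2 = 0"
    and z: "a * (z$1)\<^sup>2 + b * z$1 * z$2 + c * (z$2)\<^sup>2 = 0"
  shows "a = 0 \<and> b = 0 \<and> c = 0"
proof -
  have "a * (cross2 x y * cross2 y z * cross2 z x) = 0"
    "b * (cross2 x y * cross2 y z * cross2 z x) = 0"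
    "c * (cross2 x y * cross2 y z * cross2 z x) = 0"
    using x y z unfolding cross2_def by algebra+
  with ne show ?thesis by auto
qed

lemma circumconic_unique:
  fixes A B C P :: "real^2"
  assumes ne: "cross2 (A - P) (B - P) \<noteq> 0" "cross2 (B - P) (C - P) \<noteq> 0" "cross2 (C - P) (A - P) \<noteq> 0"
    and on: "{A, B, C} \<subseteq> frame_ellipse P u \<eta> \<zeta>"
    and E: "is_circumconic E P A B C"
  shows "E = frame_ellipse P u \<eta> \<zeta>"
proof -
  obtain a0 b0 c0 where E0: "frame_ellipse P u \<eta> \<zeta> =
       {p. a0 * ((p - P)$1)\<^sup>2 + b0 * (p - P)$1 * (p - P)$2 + c0 * ((p - P)$2)\<^sup>2 = 1}"
    using frame_ellipse_quadratic .
  obtain a b c k l m where abc: "a \<noteq> 0 \<or> b \<noteq> 0 \<or> c \<noteq> 0"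
    and E1: "E = {p. a * (p$1)\<^sup>2 + b * p$1 * p$2 + c * (p$2)\<^sup>2 + k * p$1 + l * p$2 + m = 0}"
    using E unfolding is_circumconic_def is_conic_def by blast
  \<comment> \<open>\<open>k'\<close>, \<open>l'\<close>, \<open>m'\<close> are the lower
    coefficients of the polynomial of \<open>E\<close> in coordinates about \<open>P\<close>; the
    quadratic part \<open>q\<close> keeps its coefficients.\<close>
  define k' where "k' = k + 2 * a * P$1 + b * P$2"
  define l' where "l' = l + 2 * c * P$2 + b * P$1"
  define m' where "m' = a * (P$1)\<^sup>2 + b * P$1 * P$2 + c * (P$2)\<^sup>2 + k * P$1 + l * P$2 + m"
  define q where "q z = a * (z$1)\<^sup>2 + b * z$1 * z$2 + c * (z$2)\<^sup>2" for z :: "real^2"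
  have E2: "p \<in> E \<longleftrightarrow> q (p - P) + k' * (p - P)$1 + l' * (p - P)$2 + m' = 0" for p
    unfolding E1 q_def k'_def l'_def m'_def by (simp add: power2_eq_square algebra_simps)
  \<comment> \<open>The half-turn is a symmetry of the set, not yet of the polynomial. Both
    \<open>p\<close> and its image lie on \<open>E\<close>, so the odd and even parts vanish
    separately at \<open>p\<close>.\<close>
  have half: "k' * (p - P)$1 + l' * (p - P)$2 = 0 \<and> q (p - P) + m' = 0" if "p \<in> E" for p
  proof -
    have "2 *\<^sub>R P - p \<in> E"
      using E that unfolding is_circumconic_def is_center_def by blast
    then have "q (- (p - P)) + k' * (- (p - P))$1 + l' * (- (p - P))$2 + m' = 0"
      unfolding E2 by (simp add: scaleR_2)
    moreover have "q (- (p - P)) = q (p - P)"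
      by (simp add: q_def power2_eq_square algebra_simps)
    ultimately show ?thesis
      using that unfolding E2 by (simp add: algebra_simps)
  qed
  have inE: "A \<in> E" "B \<in> E" "C \<in> E"
    using E by (auto simp: is_circumconic_def)
  \<comment> \<open>The linear part vanishes on two independent vectors, hence identically.\<close>
  have "k' * cross2 (A - P) (B - P) = 0" "l' * cross2 (A - P) (B - P) = 0"
    using half[OF inE(1)] half[OF inE(2)] unfolding cross2_def by algebra+
  then have [simp]: "k' = 0" "l' = 0"
    using ne by auto
  have *: "(a + m' * a0) * ((p - P)$1)\<^sup>2 + (b + m' * b0) * (p - P)$1 * (p - P)$2
      + (c + m' * c0) * ((p - P)$2)\<^sup>2 = 0"
    if "p \<in> E" "p \<in> frame_ellipse P u \<eta> \<zeta>" for p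
  proof -
    have "q (p - P) + m' = 0"
      using half[OF that(1)] by blast
    moreover have "a0 * ((p - P)$1)\<^sup>2 + b0 * (p - P)$1 * (p - P)$2 + c0 * ((p - P)$2)\<^sup>2 = 1"
      using that(2) unfolding E0 by blast
    ultimately show ?thesis
      unfolding q_def by algebra
  qed
  \<comment> \<open>The constant is eliminated with the equation of the ellipse, leaving a quadratic
    form that vanishes in the three vertex directions. Thus \<open>q\<close> is \<open>- m'\<close>
    times the form of the ellipse.\<close>
  have coeffs: "a + m' * a0 = 0 \<and> b + m' * b0 = 0 \<and> c + m' * c0 = 0"
    using on inE by (intro binary_quadratic_form_eq_0[OF ne] *) auto
  with abc have m': "m' \<noteq> 0"
    by auto
  have "p \<in> E \<longleftrightarrow> p \<in> frame_ellipse P u \<eta> \<zeta>" for p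
  proof -
    define q0 where "q0 = a0 * ((p - P)$1)\<^sup>2 + b0 * (p - P)$1 * (p - P)$2 + c0 * ((p - P)$2)\<^sup>2"
    have "q (p - P) = - m' * q0"
      using coeffs unfolding q_def q0_def by algebra
    then have "p \<in> E \<longleftrightarrow> m' * (1 - q0) = 0"
      unfolding E2 by (simp add: algebra_simps)
    also have "\<dots> \<longleftrightarrow> q0 = 1"
      using m' by auto
    finally show ?thesis
      unfolding E0 q0_def by simp
  qed
  then show ?thesis by blast
qed

section \<open>Tangent lines\<close>

text \<open>A unique common point forces the radius to it to be perpendicular to the line;
  \<open>n\<close> is that radius scaled to length one.\<close>

lemma tangent_to_circle_normal:
  fixes A B X :: "real^2"
  assumes "tangent_to_circle (affine hull {A, B}) X r" "r > 0" "A \<noteq> B"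
  obtains n where "norm n = 1" "(A - X) \<bullet> n = r" "(B - X) \<bullet> n = r"
proof -
  obtain T where T: "affine hull {A, B} \<inter> sphere X r = {T}"
    using assms by (auto simp: tangent_to_circle_def)
  then have Thull: "T \<in> affine hull {A, B}" and Tr: "norm (T - X) = r"
    by (auto simp: dist_norm norm_minus_commute)
  obtain s t where "s + t = 1" "T = s *\<^sub>R A + t *\<^sub>R B"
    using Thull by (auto simp: affine_hull_2)
  then have t: "T = A + t *\<^sub>R (B - A)"
    by (auto simp: algebra_simps dest: eq_diff_eq[THEN iffD2])
  define D where "D = B - A"
  have D: "D \<bullet> D \<noteq> 0"
    using assms by (simp add: D_def)
  define h where "h = - 2 * ((T - X) \<bullet> D) / (D \<bullet> D)"
  \<comment> \<open>\<open>T + h D\<close> is the reflection of \<open>T\<close> in the foot of the perpendicular from \<open>X\<close>, hence the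
    second intersection of the line with the circle.\<close>
  have "T + h *\<^sub>R D = (1 - (t + h)) *\<^sub>R A + (t + h) *\<^sub>R B"
    by (simp add: t D_def algebra_simps)
  then have "T + h *\<^sub>R D \<in> affine hull {A, B}"
    unfolding affine_hull_2 by (smt (verit) mem_Collect_eq)
  moreover have "(norm (T + h *\<^sub>R D - X))\<^sup>2 = (norm (T - X))\<^sup>2 + h * (2 * ((T - X) \<bullet> D) + h * (D \<bullet> D))"
    unfolding power2_norm_eq_inner by (simp add: inner_simps inner_commute algebra_simps)
  then have "(norm (T + h *\<^sub>R D - X))\<^sup>2 = (norm (T - X))\<^sup>2"
    using D by (simp add: h_def)
  then have "norm (T + h *\<^sub>R D - X) = r"
    using Tr assms(2) by (simp add: power2_eq_iff_nonneg)
  then have "T + h *\<^sub>R D \<in> sphere X r"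
    by (simp add: dist_norm norm_minus_commute)
  ultimately have "T + h *\<^sub>R D = T"
    using T by blast
  then have perp: "(T - X) \<bullet> (B - A) = 0"
    using D by (auto simp: h_def D_def)
  have TT: "(T - X) \<bullet> (T - X) = r\<^sup>2"
    using Tr by (simp add: power2_norm_eq_inner [symmetric])
  have "A - X = (T - X) - t *\<^sub>R (B - A)" "B - X = (T - X) + (1 - t) *\<^sub>R (B - A)"
    by (simp_all add: t algebra_simps)
  then have "(A - X) \<bullet> (T - X) = r\<^sup>2" "(B - X) \<bullet> (T - X) = r\<^sup>2"
    using perp TT by (simp_all only: inner_diff_left[of "T - X"] inner_add_left[of "T - X"]
        inner_scaleR_left inner_commute[of "B - A"] mult_zero_right diff_zero add_0_right)
  then show ?thesis
    using assms(2) Tr by (intro that[of "(1 / r) *\<^sub>R (T - X)"]) (simp_all add: power2_eq_square)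
qed

text \<open>Used to show that different sides of a triangle have different contact normals.\<close>

lemma collinear_if_common_normal:
  fixes A B C n :: "real^2"
  assumes "norm n = 1" "A \<bullet> n = r" "B \<bullet> n = r" "C \<bullet> n = r"
  shows "collinear {A, B, C}"
  unfolding collinear_def
proof (intro exI[of _ "rot90 n"] ballI)
  fix x y assume "x \<in> {A, B, C}" "y \<in> {A, B, C}"
  then have "(x - y) \<bullet> n = 0"
    using assms by (auto simp: inner_diff_left)
  then show "\<exists>c. x - y = c *\<^sub>R rot90 n"
    using frame_expansion[OF assms(1), of "x - y"] by auto
qed

text \<open>Parallel vectors with the same nonzero inner product with \<open>n\<close> coincide.
  Applied to a side, it shows that its endpoints lie in different directions from the
  incentre.\<close>

lemma cross2_neq_0_if_common_normal:
  fixes x y n :: "real^2"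
  assumes "x \<bullet> n = r" "y \<bullet> n = r" "r \<noteq> 0" "x \<noteq> y"
  shows "cross2 x y \<noteq> 0"
proof
  assume "cross2 x y = 0"
  then have "r * (x$1 - y$1) = 0" "r * (x$2 - y$2) = 0"
    using assms(1,2) unfolding cross2_def inner_vec2 by algebra+
  with assms show False
    by (simp add: vec2_eq_iff)
qed

section \<open>The circumconic in complex coordinates\<close>

lemma cnj_unit: "cmod u = 1 \<Longrightarrow> u * cnj u = 1"
  by (metis complex_norm_square of_real_1 power_one)

text \<open>Each tangent equation reads \<open>a * cnj x + cnj a * x = 2 * of_real r\<close> with
  \<open>cnj x\<close> inverse to \<open>x\<close>. Multiplying by \<open>x\<close> for
  \<open>x = v\<close> and \<open>x = w\<close> and subtracting leaves \<open>v - w\<close> as a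
  factor to cancel.\<close>

lemma tangents_intersection:
  fixes a v w :: complex
  assumes "cmod v = 1" "cmod w = 1" "v \<noteq> w" "Re (a * cnj v) = r" "Re (a * cnj w) = r"
  shows "cnj a * (v + w) = 2 * of_real r" "a * (v + w) = 2 * of_real r * v * w"
proof -
  have *: "a * cnj x + cnj a * x = 2 * of_real r" if "Re (a * cnj x) = r" for x
    using complex_add_cnj[of "a * cnj x"] unfolding that by simp
  have "(v - w) * (cnj a * (v + w) - 2 * of_real r) = 0"
    using *[OF assms(4)] *[OF assms(5)] cnj_unit[OF assms(1)] cnj_unit[OF assms(2)] by algebra
  then show 1: "cnj a * (v + w) = 2 * of_real r"
    using assms(3) by simp
  show "a * (v + w) = 2 * of_real r * v * w"
    using 1 *[OF assms(4)] cnj_unit[OF assms(1)] cnj_unit[OF assms(2)] by algebra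
qed

lemma quadratic_three_roots:
  fixes p q s x y z :: "'a::idom"
  assumes "p * x\<^sup>2 + q * x + s = 0" "p * y\<^sup>2 + q * y + s = 0" "p * z\<^sup>2 + q * z + s = 0"
    and "x \<noteq> y" "y \<noteq> z" "z \<noteq> x"
  shows "p = 0"
proof -
  have "p * ((x - y) * (y - z) * (z - x)) = 0"
    using assms(1-3) by algebra
  with assms show ?thesis by simp
qed

text \<open>The identity is a quadratic equation satisfied by \<open>u\<close> whose coefficients are symmetric in
  the three contact directions; its leading coefficient is \<open>o + R (u + v + w)\<close>.\<close>

lemma contact_quadratic:
  fixes a o' u v w :: complex
  assumes a: "cnj a * (v + w) = 2 * of_real r" "a * (v + w) = 2 * of_real r * v * w"
    and R: "cmod (a - o') = R" and d: "cmod o' = d" and Euler: "R\<^sup>2 - d\<^sup>2 = 2 * R * r" and r: "r \<noteq> 0"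
    and e1: "e1 = u + v + w" and e2: "e2 = u * v + v * w + w * u" and e3: "e3 = u * v * w"
  shows "(o' + of_real R * e1) * u\<^sup>2
    + (e3 * cnj o' - o' * e1 - of_real R * (e1\<^sup>2 - e2)) * u
    + (2 * of_real r * e3 - e3 * cnj o' * e1 - of_real R * e3) = 0"
proof -
  have "(a - o') * (cnj a - cnj o') = (of_real R)\<^sup>2" "o' * cnj o' = (of_real d)\<^sup>2"
    using R d complex_norm_square[of "a - o'"] complex_norm_square[of o'] by auto
  moreover have "(of_real R)\<^sup>2 - (of_real d)\<^sup>2 = (2 * of_real R * of_real r :: complex)"
    using arg_cong[OF Euler, of complex_of_real] by simp
  ultimately have "a * cnj a - a * cnj o' - cnj a * o' = 2 * of_real R * of_real r"
    by algebra
  \<comment> \<open>The circle equation is multiplied by \<open>(v + w)^2\<close>, so that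
    \<open>a\<close> and \<open>cnj a\<close> can be replaced through the tangent equations.\<close>
  then have "2 * of_real r * (2 * of_real r * v * w - (v * w * cnj o' + o') * (v + w)
      - of_real R * (v + w)\<^sup>2) = 0"
    using a by algebra
  then have "2 * of_real r * v * w - (v * w * cnj o' + o') * (v + w) - of_real R * (v + w)\<^sup>2 = 0"
    using r by simp
  \<comment> \<open>Multiplication by \<open>u\<close> and \<open>v + w = e1 - u\<close> produce the
    quadratic in \<open>u\<close>.\<close>
  then show ?thesis
    unfolding e1 e2 e3 by algebra
qed

text \<open>After multiplication by \<open>(v + w)^2\<close> the vertex is eliminated, and an
  identity between unit complex numbers remains.\<close>

lemma contact_form:
  fixes a u v w :: complex
  assumes u: "cmod u = 1" "cmod v = 1" "cmod w = 1" and r: "r \<noteq> 0"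
    and a: "cnj a * (v + w) = 2 * of_real r" "a * (v + w) = 2 * of_real r * v * w"
  shows "(1 + (cmod (u + v + w))\<^sup>2) * (cmod a)\<^sup>2
    - 2 * Re ((u + v + w) * cnj (u * v * w) * a\<^sup>2) = 4 * r\<^sup>2"
proof -
  let ?e = "u + v + w"
  let ?g = "?e * cnj (u * v * w)"
  have vw: "v + w \<noteq> 0"
    using a(1) r by auto
  have units: "u * cnj u = 1" "v * cnj v = 1" "w * cnj w = 1"
    using u by (simp_all add: cnj_unit)
  have "((1 + ?e * cnj ?e) * (a * cnj a) - (?g * a\<^sup>2 + cnj ?g * (cnj a)\<^sup>2) - 4 * of_real r ^ 2) * (v + w)\<^sup>2
      = 4 * (of_real r)\<^sup>2 * ((1 + ?e * cnj ?e) * (v * w) - (?g * (v * w)\<^sup>2 + cnj ?g) - (v + w)\<^sup>2)"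
    using a by algebra
  \<comment> \<open>Since \<open>cnj\<close> inverts units, the first two terms combine to
    \<open>v * w * (?e - u) * cnj (?e - u)\<close>. With \<open>?e - u = v + w\<close> this is
    \<open>(v + w)^2\<close>.\<close>
  also have "(1 + ?e * cnj ?e) * (v * w) - (?g * (v * w)\<^sup>2 + cnj ?g) - (v + w)\<^sup>2 = 0"
    using units unfolding complex_cnj_add complex_cnj_mult complex_cnj_cnj by algebra
  finally have "(1 + ?e * cnj ?e) * (a * cnj a) - (?g * a\<^sup>2 + cnj ?g * (cnj a)\<^sup>2) = 4 * of_real r ^ 2"
    using vw by simp
  then have "(1 + of_real ((cmod ?e)\<^sup>2)) * of_real ((cmod a)\<^sup>2)
      - (?g * a\<^sup>2 + cnj ?g * (cnj a)\<^sup>2) = 4 * of_real r ^ 2"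
    by (simp only: complex_norm_square)
  moreover have "?g * a\<^sup>2 + cnj ?g * (cnj a)\<^sup>2 = of_real (2 * Re (?g * a\<^sup>2))"
    using complex_add_cnj[of "?g * a\<^sup>2"] by simp
  ultimately have "of_real ((1 + (cmod ?e)\<^sup>2) * (cmod a)\<^sup>2 - 2 * Re (?g * a\<^sup>2)) = complex_of_real (4 * r\<^sup>2)"
    by (simp only: of_real_mult of_real_add of_real_diff of_real_1 of_real_power
        of_real_numeral)
  then show ?thesis
    by (simp only: of_real_eq_iff)
qed

text \<open>Rotating the coordinate by \<open>k\<close> makes the coefficient of the square real and
  nonnegative, which removes the mixed term.\<close>

lemma form_diagonalization:
  fixes g :: complex
  obtains k where "cmod k = 1"
    "\<And>z. (1 + (cmod g)\<^sup>2) * (cmod z)\<^sup>2 - 2 * Re (g * z\<^sup>2)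
       = ((1 - cmod g) * Re (z * cnj k))\<^sup>2 + ((1 + cmod g) * Im (z * cnj k))\<^sup>2"
proof -
  \<comment> \<open>\<open>k\<close> is a unit with \<open>g * k^2 = cmod g\<close>; for
    \<open>g = 0\<close> any unit would do.\<close>
  define k where "k = (if g = 0 then 1 else csqrt (cnj g / of_real (cmod g)))"
  have k2: "g * k\<^sup>2 = of_real (cmod g)"
    using complex_norm_square[of g] by (simp add: k_def field_simps power2_eq_square[of "of_real _"])
  have k1: "cmod k = 1"
    by (simp add: k_def norm_divide)
  have "(1 + (cmod g)\<^sup>2) * (cmod z)\<^sup>2 - 2 * Re (g * z\<^sup>2)
       = ((1 - cmod g) * Re (z * cnj k))\<^sup>2 + ((1 + cmod g) * Im (z * cnj k))\<^sup>2" for z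
  proof -
    define s where "s = z * cnj k"
    have z: "z = s * k"
      using cnj_unit[OF k1] unfolding s_def by algebra
    have "g * z\<^sup>2 = of_real (cmod g) * s\<^sup>2"
      unfolding z k2[symmetric] by (simp add: power_mult_distrib)
    then have "Re (g * z\<^sup>2) = cmod g * ((Re s)\<^sup>2 - (Im s)\<^sup>2)"
      by (simp add: power2_eq_square)
    moreover have "(cmod z)\<^sup>2 = (Re s)\<^sup>2 + (Im s)\<^sup>2"
      using k1 by (simp add: z norm_mult cmod_power2)
    ultimately show ?thesis
      unfolding s_def[symmetric] by algebra
  qed
  with k1 show ?thesis using that by blast
qed

text \<open>Each vertex is paired with the normal of the opposite side: \<open>a\<close> lies on the
  tangents with normals \<open>v\<close> and \<open>w\<close>, and cyclically.\<close>

lemma poristic_complex: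
  fixes a b c o' u v w :: complex
  assumes units: "cmod u = 1" "cmod v = 1" "cmod w = 1" and distinct: "u \<noteq> v" "v \<noteq> w" "w \<noteq> u"
    and a: "Re (a * cnj v) = r" "Re (a * cnj w) = r"
    and b: "Re (b * cnj w) = r" "Re (b * cnj u) = r"
    and c: "Re (c * cnj u) = r" "Re (c * cnj v) = r"
    and circ: "cmod (a - o') = R" "cmod (b - o') = R" "cmod (c - o') = R"
    and d: "cmod o' = d" and Euler: "R\<^sup>2 - d\<^sup>2 = 2 * R * r" and r: "r > 0" and R: "R > 0"
  obtains k where "cmod k = 1"
    "\<And>z. z \<in> {a, b, c} \<Longrightarrow> (Re (z * cnj k) / (R + d))\<^sup>2 + (Im (z * cnj k) / (R - d))\<^sup>2 = 1"
proof -
  define e1 where "e1 = u + v + w"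
  define e2 where "e2 = u * v + v * w + w * u"
  define e3 where "e3 = u * v * w"
  note ta = tangents_intersection[OF units(2,3) distinct(2) a]
    and tb = tangents_intersection[OF units(3,1) distinct(3) b]
    and tc = tangents_intersection[OF units(1,2) distinct(1) c]
  let ?p = "o' + of_real R * e1"
    and ?q = "e3 * cnj o' - o' * e1 - of_real R * (e1\<^sup>2 - e2)"
    and ?s = "2 * of_real r * e3 - e3 * cnj o' * e1 - of_real R * e3"
  have "r \<noteq> 0" using r by simp
  have "?p * u\<^sup>2 + ?q * u + ?s = 0"
    by (rule contact_quadratic[OF ta circ(1) d Euler \<open>r \<noteq> 0\<close>]) (simp_all add: e1_def e2_def e3_def)
  moreover have "?p * v\<^sup>2 + ?q * v + ?s = 0"
    by (rule contact_quadratic[OF tb circ(2) d Euler \<open>r \<noteq> 0\<close>]) (simp_all add: e1_def e2_def e3_def)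
  moreover have "?p * w\<^sup>2 + ?q * w + ?s = 0"
    by (rule contact_quadratic[OF tc circ(3) d Euler \<open>r \<noteq> 0\<close>]) (simp_all add: e1_def e2_def e3_def)
  \<comment> \<open>The coefficients are symmetric in the normals, so one quadratic has the three
    distinct roots \<open>u\<close>, \<open>v\<close>, \<open>w\<close>.\<close>
  ultimately have "?p = 0"
    using distinct by (rule quadratic_three_roots)
  then have "o' = - of_real R * e1"
    by (simp add: add_eq_0_iff)
  then have e1d: "cmod e1 = d / R"
    using d R by (auto simp: norm_mult)
  define g where "g = e1 * cnj e3"
  have gd: "cmod g = d / R"
    using e1d units by (simp add: g_def e3_def norm_mult)
  have "d < R" "d \<ge> 0"
  proof -
    show "d \<ge> 0" using d by auto
    have "d\<^sup>2 < R\<^sup>2" using Euler mult_pos_pos[OF R r] by linarith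
    then show "d < R" using R by (simp add: power2_less_imp_less)
  qed
  obtain k where k: "cmod k = 1"
    "\<And>z. (1 + (cmod g)\<^sup>2) * (cmod z)\<^sup>2 - 2 * Re (g * z\<^sup>2)
       = ((1 - cmod g) * Re (z * cnj k))\<^sup>2 + ((1 + cmod g) * Im (z * cnj k))\<^sup>2"
    using form_diagonalization[of g] by blast
  have form: "(1 + (cmod g)\<^sup>2) * (cmod z)\<^sup>2 - 2 * Re (g * z\<^sup>2) = 4 * r\<^sup>2" if z: "z \<in> {a, b, c}" for z
  proof -
    have perms: "v + w + u = e1" "w + u + v = e1" "v * w * u = e3" "w * u * v = e3"
      by (simp_all add: e1_def e3_def)
    have "(1 + (cmod e1)\<^sup>2) * (cmod z)\<^sup>2 - 2 * Re (e1 * cnj e3 * z\<^sup>2) = 4 * r\<^sup>2"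
      using z contact_form[OF units \<open>r \<noteq> 0\<close> ta, folded e1_def e3_def]
        contact_form[OF units(2,3,1) \<open>r \<noteq> 0\<close> tb, unfolded perms]
        contact_form[OF units(3,1,2) \<open>r \<noteq> 0\<close> tc, unfolded perms] by blast
    then show ?thesis
      using e1d gd by (simp add: g_def)
  qed
  have "(Re (z * cnj k) / (R + d))\<^sup>2 + (Im (z * cnj k) / (R - d))\<^sup>2 = 1" if z: "z \<in> {a, b, c}" for z
  proof -
    \<comment> \<open>This converts the factors \<open>1 - d / R\<close> and
      \<open>1 + d / R\<close> of the diagonal form into \<open>2 * r\<close> over the
      semiaxes.\<close>
    have prod: "(R + d) * (R - d) = 2 * R * r"
      using Euler by (simp add: power2_eq_square algebra_simps)
    have "(1 - d / R) * (R + d) = 2 * r" "(1 + d / R) * (R - d) = 2 * r"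
      using prod R by (simp_all add: field_simps)
    then have "1 - d / R = 2 * r / (R + d)" "1 + d / R = 2 * r / (R - d)"
      using \<open>d < R\<close> \<open>0 \<le> d\<close> by (simp_all add: eq_divide_eq)
    then have "4 * r\<^sup>2 * ((Re (z * cnj k) / (R + d))\<^sup>2 + (Im (z * cnj k) / (R - d))\<^sup>2) = 4 * r\<^sup>2"
      using k(2)[of z] form[OF z] unfolding gd
      by (simp only: times_divide_eq_left power_mult_distrib power_divide distrib_left) simp
    then show ?thesis using r by simp
  qed
  with k(1) show ?thesis using that by blast
qed

section \<open>The Poristic family\<close>

definition cplx :: "real^2 \<Rightarrow> complex" where
  "cplx z = Complex (z$1) (z$2)"

lemma cplx_diff: "cplx (x - y) = cplx x - cplx y"
  by (simp add: cplx_def complex_eq_iff)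

lemma cplx_eq_iff: "cplx x = cplx y \<longleftrightarrow> x = y"
  by (simp add: cplx_def vec2_eq_iff)

lemma cmod_cplx: "cmod (cplx z) = norm z"
  by (simp add: cplx_def cmod_def norm_eq_sqrt_inner inner_vec2 power2_eq_square)

text \<open>Links the complex normal form to \<open>frame_ellipse\<close>: for a unit
  \<open>u\<close>, multiplication by \<open>cnj (cplx u)\<close> reads off the coordinates in the
  frame of \<open>u\<close>.\<close>

lemma cplx_mult_cnj:
  "Re (cplx z * cnj (cplx u)) = z \<bullet> u" "Im (cplx z * cnj (cplx u)) = z \<bullet> rot90 u"
  by (simp_all add: cplx_def inner_vec2)

lemma cplx_surj: "\<exists>z. cplx z = k"
  by (rule exI[of _ "vector [Re k, Im k]"]) (simp add: cplx_def)

lemma poristic_frame_ellipse: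
  fixes X1 X3 A B C :: "real^2"
  assumes por: "poristic X3 R X1 r A B C" and r: "r > 0" and R: "R > 0"
    and d: "dist X1 X3 = d" and Euler: "R\<^sup>2 - d\<^sup>2 = 2 * R * r"
  obtains u where "norm u = 1" "{A, B, C} \<subseteq> frame_ellipse X1 u (R + d) (R - d)"
    "cross2 (A - X1) (B - X1) \<noteq> 0" "cross2 (B - X1) (C - X1) \<noteq> 0" "cross2 (C - X1) (A - X1) \<noteq> 0"
proof -
  have ncol: "\<not> collinear {A, B, C}"
    and circ: "dist X3 A = R" "dist X3 B = R" "dist X3 C = R"
    and tan: "tangent_to_circle (affine hull {A, B}) X1 r"
      "tangent_to_circle (affine hull {B, C}) X1 r" "tangent_to_circle (affine hull {C, A}) X1 r"
    using por by (auto simp: poristic_def is_triangle_def is_circumcircle_def is_incircle_def)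
  have ne: "A \<noteq> B" "B \<noteq> C" "C \<noteq> A"
    using ncol by (auto simp: insert_commute)
  obtain w where w: "norm w = 1" "(A - X1) \<bullet> w = r" "(B - X1) \<bullet> w = r"
    using tangent_to_circle_normal[OF tan(1) r ne(1)] .
  obtain u where u: "norm u = 1" "(B - X1) \<bullet> u = r" "(C - X1) \<bullet> u = r"
    using tangent_to_circle_normal[OF tan(2) r ne(2)] .
  obtain v where v: "norm v = 1" "(C - X1) \<bullet> v = r" "(A - X1) \<bullet> v = r"
    using tangent_to_circle_normal[OF tan(3) r ne(3)] .
  have no_common: "\<not> (norm n = 1 \<and> (A - X1) \<bullet> n = r \<and> (B - X1) \<bullet> n = r \<and> (C - X1) \<bullet> n = r)" for n
    using collinear_if_common_normal[of n A "r + X1 \<bullet> n" B C] ncol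
    by (auto simp: inner_diff_left algebra_simps)
  \<comment> \<open>Two equal normals would place all three vertices on one line.\<close>
  have distinct: "u \<noteq> v" "v \<noteq> w" "w \<noteq> u"
    using u v w no_common[of u] no_common[of v] by auto
  have Xd: "norm (X3 - X1) = d"
    using d by (simp add: dist_norm norm_minus_commute)
  have circ': "norm ((Z - X1) - (X3 - X1)) = R" if "dist X3 Z = R" for Z
    using that by (simp add: dist_norm norm_minus_commute)
  obtain k where k: "cmod k = 1"
    "\<And>z. z \<in> {cplx (A - X1), cplx (B - X1), cplx (C - X1)} \<Longrightarrow>
       (Re (z * cnj k) / (R + d))\<^sup>2 + (Im (z * cnj k) / (R - d))\<^sup>2 = 1"
  proof (rule poristic_complex[of "cplx u" "cplx v" "cplx w" "cplx (A - X1)" r "cplx (B - X1)"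
        "cplx (C - X1)" "cplx (X3 - X1)" R d])
    show "cmod (cplx (A - X1) - cplx (X3 - X1)) = R" "cmod (cplx (B - X1) - cplx (X3 - X1)) = R"
      "cmod (cplx (C - X1) - cplx (X3 - X1)) = R"
      using circ circ' by (simp_all only: cplx_diff[symmetric] cmod_cplx)
  qed (use u v w distinct r R Euler Xd in \<open>simp_all only: cmod_cplx cplx_mult_cnj cplx_eq_iff simp_thms\<close>)
  obtain n where n: "cplx n = k"
    using cplx_surj by blast
  show ?thesis
  proof (rule that[of n])
    show "norm n = 1"
      using k(1) n cmod_cplx by metis
    show "{A, B, C} \<subseteq> frame_ellipse X1 n (R + d) (R - d)"
      using k(2)[unfolded n[symmetric], of "cplx _", unfolded cplx_mult_cnj]
      by (simp add: frame_ellipse_def)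
    show "cross2 (A - X1) (B - X1) \<noteq> 0" "cross2 (B - X1) (C - X1) \<noteq> 0" "cross2 (C - X1) (A - X1) \<noteq> 0"
      using cross2_neq_0_if_common_normal[OF w(2,3)] cross2_neq_0_if_common_normal[OF u(2,3)]
        cross2_neq_0_if_common_normal[OF v(2,3)] r ne by auto
  qed
qed

lemma poristic_circumconic:
  fixes X1 X3 A B C :: "real^2"
  assumes "poristic X3 R X1 r A B C" "r > 0" "R > 0" "dist X1 X3 = d" "R\<^sup>2 - d\<^sup>2 = 2 * R * r"
  obtains u where "norm u = 1"
    "\<And>E. is_circumconic E X1 A B C \<longleftrightarrow> E = frame_ellipse X1 u (R + d) (R - d)"
proof -
  obtain u where u: "norm u = 1" and on: "{A, B, C} \<subseteq> frame_ellipse X1 u (R + d) (R - d)"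
    and ne: "cross2 (A - X1) (B - X1) \<noteq> 0" "cross2 (B - X1) (C - X1) \<noteq> 0"
      "cross2 (C - X1) (A - X1) \<noteq> 0"
    using poristic_frame_ellipse[OF assms] .
  have "is_circumconic (frame_ellipse X1 u (R + d) (R - d)) X1 A B C"
    using on frame_ellipse_is_conic[of A] frame_ellipse_is_center
    by (auto simp: is_circumconic_def)
  then show ?thesis
    using that[OF u] circumconic_unique[OF ne on] by blast
qed

theorem theorem3:
  fixes X1 X3 :: "real^2" and R r d :: real
  assumes "R \<ge> 2 * r" and "2 * r > 0"
    and "d = sqrt (R * (R - 2 * r))"
    and "dist X1 X3 = d"
  shows "(\<forall>A B C. poristic X3 R X1 r A B C \<longrightarrow>
            (\<exists>!E1. is_circumconic E1 X1 A B C) \<and>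
            (\<forall>E1. is_circumconic E1 X1 A B C \<longrightarrow>
               (\<forall>\<eta>1 \<zeta>1. ellipse_with_semiaxes E1 X1 \<eta>1 \<zeta>1 \<longleftrightarrow> \<eta>1 = R + d \<and> \<zeta>1 = R - d)))
       \<and> (\<forall>A B C A' B' C' E1 E1'.
            poristic X3 R X1 r A B C \<and> is_circumconic E1 X1 A B C \<and>
            poristic X3 R X1 r A' B' C' \<and> is_circumconic E1' X1 A' B' C' \<longrightarrow>
            (\<exists>Q :: real^2^2. rotation_matrix Q \<and>
               E1' = (\<lambda>p. X1 + Q *v (p - X1)) ` E1))"
proof -
  have r: "r > 0" and R: "R > 0"
    using assms by auto
  have "d\<^sup>2 = R * (R - 2 * r)"
    using assms R by simp
  then have Euler: "R\<^sup>2 - d\<^sup>2 = 2 * R * r"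
    by (simp add: power2_eq_square algebra_simps)
  have "d \<ge> 0"
    using assms(4) by auto
  have "R * r > 0" using r R by simp
  then have "d\<^sup>2 < R\<^sup>2" using Euler by linarith
  then have "d < R" using R by (simp add: power2_less_imp_less)
  \<comment> \<open>Only the direction \<open>u\<close> depends on the triangle; centre and semiaxes
    do not, which is the source of the rigid rotation.\<close>
  have conic: "\<exists>u. norm u = 1 \<and>
      (\<forall>E. is_circumconic E X1 A B C \<longleftrightarrow> E = frame_ellipse X1 u (R + d) (R - d))"
    if "poristic X3 R X1 r A B C" for A B C
    using poristic_circumconic[OF that r R assms(4) Euler] by metis
  have semiaxes: "ellipse_with_semiaxes (frame_ellipse X1 u (R + d) (R - d)) X1 \<eta> \<zeta> \<longleftrightarrow>
      \<eta> = R + d \<and> \<zeta> = R - d" if "norm u = 1" for u \<eta> \<zeta>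
  proof -
    have "ellipse_with_semiaxes (frame_ellipse X1 u (R + d) (R - d)) X1 (R + d) (R - d)"
      unfolding ellipse_with_semiaxes_iff using that \<open>d \<ge> 0\<close> \<open>d < R\<close> by auto
    then show ?thesis
      using ellipse_with_semiaxes_unique by blast
  qed
  show ?thesis
  proof (intro conjI allI impI)
    fix A B C assume "poristic X3 R X1 r A B C"
    then show "\<exists>!E1. is_circumconic E1 X1 A B C"
      using conic by metis
  next
    fix A B C E1 \<eta>1 \<zeta>1
    assume "poristic X3 R X1 r A B C" "is_circumconic E1 X1 A B C"
    then show "ellipse_with_semiaxes E1 X1 \<eta>1 \<zeta>1 \<longleftrightarrow> \<eta>1 = R + d \<and> \<zeta>1 = R - d"
      using conic semiaxes by metis
  next
    fix A B C A' B' C' E1 E1'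
    assume *: "poristic X3 R X1 r A B C \<and> is_circumconic E1 X1 A B C \<and>
      poristic X3 R X1 r A' B' C' \<and> is_circumconic E1' X1 A' B' C'"
    obtain u where u: "norm u = 1" "E1 = frame_ellipse X1 u (R + d) (R - d)"
      using * conic[of A B C] by metis
    obtain u' where u': "norm u' = 1" "E1' = frame_ellipse X1 u' (R + d) (R - d)"
      using * conic[of A' B' C'] by metis
    show "\<exists>Q :: real^2^2. rotation_matrix Q \<and> E1' = (\<lambda>p. X1 + Q *v (p - X1)) ` E1"
      unfolding u(2) u'(2) using frame_ellipse_rotation[OF u(1) u'(1)] .
  qed
qed

end
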